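(* Let $N>p>1$ and assume that $f$ satisfies assumptions (H1), (H2) and (H3) (listed in the context). Then any bounded solution $u$ of $$\left(r^{N-1}\phi_p(u')\right)'+r^{N-1}f(u)=0,\quad r>0,\qquad u'(0)=0,\quad \lim_{r\to\infty}u(r)=0,$$ has compact support.
   Context: $N$ is an integer and $p$ is real. $\phi_p(s)=|s|^{p-2}s$ for $s\ne0$, $\phi_p(0)=0$. $F(u)=\int_0^u f(s)\,ds$. A solution is a function $u\in C^1([0,\infty))$ with $|u'|^{p-2}u'\in C^1(0,\infty)$ satisfying the equation and the conditions; it is not assumed to have a sign. Assumptions on $f$: (H1) $f$ is continuous on $\mathbb R$, locally Lipschitz on $\mathbb R\setminus\{0\}$, with $f(0)=0$. (H2) There exist constants $a>0$ and $b<0$ such that $f$ is strictly decreasing on $(b,a)$, and $a$ (resp. $b$) is a local minimum (resp. local maximum) of $f$. (H3) $u\mapsto|F(u)|^{-1/p}$ is locally integrable near $0$; more generally, $u\mapsto|F(x_0)-F(u)|^{-1/p}$ is locally integrable near $x_0\neq0$ whenever $x_0$ is a local maximum of $F$. *)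

theory Defs
  imports "HOL-Analysis.Analysis"
begin

definition phi_p :: "real \<Rightarrow> real \<Rightarrow> real" where
  "phi_p p s = (if s = 0 then 0 else \<bar>s\<bar> powr (p - 2) * s)"

(* The interval integral is oriented, so for u < 0 this is minus the integral over [u, 0]. *)
definition primitive :: "(real \<Rightarrow> real) \<Rightarrow> real \<Rightarrow> real" where
  "primitive f u = (LBINT s=ereal 0..ereal u. f s)"

definition local_min_at :: "(real \<Rightarrow> real) \<Rightarrow> real \<Rightarrow> bool" where
  "local_min_at g x \<longleftrightarrow> (\<forall>\<^sub>F y in nhds x. g x \<le> g y)"

definition local_max_at :: "(real \<Rightarrow> real) \<Rightarrow> real \<Rightarrow> bool" where
  "local_max_at g x \<longleftrightarrow> (\<forall>\<^sub>F y in nhds x. g y \<le> g x)"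

definition locally_integrable_near :: "(real \<Rightarrow> ennreal) \<Rightarrow> real \<Rightarrow> bool" where
  "locally_integrable_near g x \<longleftrightarrow>
     (\<exists>e>0. (\<lambda>u. g u * indicator {x - e..x + e} u) \<in> borel_measurable lborel \<and>
            (\<integral>\<^sup>+u\<in>{x - e..x + e}. g u \<partial>lborel) < \<infinity>)"

(* The parameter set of the library's local_lipschitz plays no role here. *)
definition H1 :: "(real \<Rightarrow> real) \<Rightarrow> bool" where
  "H1 f \<longleftrightarrow> continuous_on UNIV f \<and> local_lipschitz {0::real} (- {0}) (\<lambda>_. f) \<and> f 0 = 0"

definition H2 :: "(real \<Rightarrow> real) \<Rightarrow> bool" where
  "H2 f \<longleftrightarrow>
     (\<exists>a b. 0 < a \<and> b < 0 \<and> strict_antimono_on {b<..<a} f \<and> local_min_at f a \<and> local_max_at f b)"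

(* The negative power is written as a reciprocal in ennreal, where 1 / 0 = \<infinity>.  The real-valued
   powr has 0 powr (- 1 / p) = 0, which would make the condition vacuous where F is constant. *)
definition H3 :: "real \<Rightarrow> (real \<Rightarrow> real) \<Rightarrow> bool" where
  "H3 p f \<longleftrightarrow>
     locally_integrable_near (\<lambda>u. 1 / ennreal (\<bar>primitive f u\<bar> powr (1 / p))) 0 \<and>
     (\<forall>x0. x0 \<noteq> 0 \<and> local_max_at (primitive f) x0 \<longrightarrow>
        locally_integrable_near
          (\<lambda>u. 1 / ennreal (\<bar>primitive f x0 - primitive f u\<bar> powr (1 / p))) x0)"

(* Only the values of u on [0, \<infinity>) matter; u' is its derivative there, one-sided at 0. *)
definition radial_solution :: "nat \<Rightarrow> real \<Rightarrow> (real \<Rightarrow> real) \<Rightarrow> (real \<Rightarrow> real) \<Rightarrow> bool" where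
  "radial_solution N p f u \<longleftrightarrow>
     (\<exists>u'. (\<forall>r\<ge>0. (u has_real_derivative u' r) (at r within {0..})) \<and>
           continuous_on {0..} u' \<and>
           (\<lambda>r. phi_p p (u' r)) C1_differentiable_on {0<..} \<and>
           (\<forall>r>0. deriv (\<lambda>t. t ^ (N - 1) * phi_p p (u' t)) r + r ^ (N - 1) * f (u r) = 0) \<and>
           u' 0 = 0) \<and>
     (u \<longlongrightarrow> 0) at_top"

definition compact_support :: "(real \<Rightarrow> real) \<Rightarrow> bool" where
  "compact_support u \<longleftrightarrow> compact (closure {r. 0 \<le> r \<and> u r \<noteq> 0})"

end

theory Submission
  imports Defs
begin

text \<open>
  Write \<open>F\<close> for the primitive of \<open>f\<close> and let \<open>c > 0\<close> be so small that \<open>f\<close> and the identity have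
  opposite signs on the punctured interval \<open>(-c, c)\<close>; then \<open>F < 0\<close> there.  Let \<open>R > 0\<close> be so large that
  \<open>\<bar>u\<bar> < c\<close> on \<open>[R, \<infinity>)\<close>.  Three observations give the result.

  The energy \<open>E = (p - 1)/p \<bar>u'\<bar>\<^sup>p + F(u)\<close> has derivative \<open>-(N - 1)/r \<bar>u'\<bar>\<^sup>p \<le> 0\<close>, and \<open>E \<ge> F(u) \<rightarrow> 0\<close>
  at infinity; hence \<open>E \<ge> 0\<close> (lemma \<open>energy_nonneg\<close>), which bounds \<open>\<bar>u'\<bar>\<close> below by a positive
  multiple of \<open>\<bar>F(u)\<bar> powr (1/p)\<close> on \<open>[R, \<infinity>)\<close>.

  The product of \<open>u\<close> and the flux \<open>r ^ (N - 1) * phi_p p (u' r)\<close> is nondecreasing on \<open>[R, \<infinity>)\<close>, because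
  \<open>u f(u) \<le> 0\<close>.  Once it is nonnegative, \<open>u\<^sup>2\<close> is nondecreasing, and since it tends to \<open>0\<close> it vanishes
  from there on (lemma \<open>vanishes_of_flux_nonneg\<close>).  In particular, a single zero of \<open>u\<close> in \<open>[R, \<infinity>)\<close>
  makes \<open>u\<close> vanish beyond it, and as long as \<open>u \<noteq> 0\<close> the values \<open>u\<close> and \<open>u'\<close> have opposite signs.

  If \<open>u\<close> had no zero in \<open>[R, \<infinity>)\<close>, then \<open>\<bar>u\<bar>\<close> would decrease to \<open>0\<close> with speed at least a multiple of
  \<open>\<bar>F(u)\<bar> powr (1/p)\<close>.  The time needed for this is bounded by a multiple of the integral of
  \<open>\<bar>F\<bar> powr (-1/p)\<close> near \<open>0\<close>, which is finite by the integrability hypothesis (lemma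
  \<open>travel_time_bound\<close>): a contradiction.
\<close>

section \<open>The odd power map\<close>

lemma mult_phi_p: "s * phi_p p s = \<bar>s\<bar> powr p"
proof (cases "s = 0")
  case False
  have "s * phi_p p s = \<bar>s\<bar> powr (p - 2) * \<bar>s\<bar> powr 2"
    using False by (simp add: phi_p_def power2_eq_square flip: abs_mult)
  also have "\<dots> = \<bar>s\<bar> powr p"
    by (simp only: powr_add [symmetric]) simp
  finally show ?thesis .
qed (simp add: phi_p_def)

lemma abs_phi_p: "\<bar>phi_p p s\<bar> = \<bar>s\<bar> powr (p - 1)"
proof (cases "s = 0")
  case False
  have "\<bar>phi_p p s\<bar> = \<bar>s\<bar> powr (p - 2) * \<bar>s\<bar> powr 1"
    using False by (simp add: phi_p_def abs_mult)
  also have "\<dots> = \<bar>s\<bar> powr (p - 1)"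
    by (simp only: powr_add [symmetric]) (simp add: algebra_simps)
  finally show ?thesis .
qed (simp add: phi_p_def)

text \<open>The power maps of conjugate exponents are inverse to each other.  This allows
  \<open>\<bar>u'\<bar> powr p\<close> to be differentiated through \<open>phi_p p u'\<close>, although \<open>u'\<close> itself need not be
  differentiable.\<close>

lemma phi_p_conjugate:
  assumes "1 < p"
  shows "phi_p (p / (p - 1)) (phi_p p s) = s"
proof (cases "s = 0")
  case False
  have "phi_p (p / (p - 1)) (phi_p p s)
      = (\<bar>s\<bar> powr (p - 1)) powr (p / (p - 1) - 2) * (\<bar>s\<bar> powr (p - 2) * s)"
    using False by (simp add: phi_p_def [of "p / (p - 1)"] abs_phi_p) (simp add: phi_p_def)
  also have "\<dots> = \<bar>s\<bar> powr ((p - 1) * (p / (p - 1) - 2) + (p - 2)) * s"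
    by (simp add: powr_powr powr_add)
  also have "(p - 1) * (p / (p - 1) - 2) + (p - 2) = 0"
    using assms by (simp add: field_simps)
  finally show ?thesis using False by simp
qed (simp add: phi_p_def)

lemma has_real_derivative_abs_powr:
  assumes "1 < q"
  shows "((\<lambda>x. \<bar>x\<bar> powr q) has_real_derivative q * phi_p q x) (at x)"
proof -
  consider "x > 0" | "x < 0" | "x = 0" by linarith
  then show ?thesis
  proof cases
    case 1
    have "((\<lambda>x. x powr q) has_real_derivative q * x powr (q - 1)) (at x)"
      using 1 by (rule has_real_derivative_powr)
    moreover have "x powr (q - 1) = phi_p q x"
      using 1 abs_phi_p [of q x] by (simp add: phi_p_def abs_mult)
    ultimately have "((\<lambda>x. x powr q) has_real_derivative q * phi_p q x) (at x)" by simp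
    then show ?thesis
      by (rule has_field_derivative_transform_within_open [where S = "{0<..}"]) (use 1 in auto)
  next
    case 2
    have "((\<lambda>x. (- x) powr q) has_real_derivative (q * (- x) powr (q - 1)) * (- 1)) (at x)"
      by (rule DERIV_chain2 [where f = "\<lambda>x. x powr q"], rule has_real_derivative_powr)
        (use 2 in \<open>auto intro!: derivative_eq_intros\<close>)
    moreover have "(- x) powr (q - 1) = - phi_p q x"
      using 2 abs_phi_p [of q x] by (simp add: phi_p_def abs_mult)
    ultimately have "((\<lambda>x. (- x) powr q) has_real_derivative q * phi_p q x) (at x)" by simp
    then show ?thesis
      by (rule has_field_derivative_transform_within_open [where S = "{..<0}"]) (use 2 in auto)
  next
    case 3
    have "((\<lambda>h::real. \<bar>h\<bar> powr (q - 1)) \<longlongrightarrow> \<bar>0\<bar> powr (q - 1)) (at 0)"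
      by (rule tendsto_powr2) (use assms in \<open>auto intro!: tendsto_rabs_zero tendsto_ident_at\<close>)
    then have "((\<lambda>h::real. \<bar>h\<bar> powr (q - 1)) \<longlongrightarrow> 0) (at 0)" by simp
    then have "((\<lambda>h::real. phi_p q h) \<longlongrightarrow> 0) (at 0)"
      by (subst tendsto_rabs_zero_iff [symmetric]) (simp add: abs_phi_p)
    moreover have "phi_p q h = (\<bar>h\<bar> powr q - \<bar>0\<bar> powr q) / h" if "h \<noteq> 0" for h
      using that mult_phi_p [of h q] by (simp add: field_simps)
    ultimately have "((\<lambda>h::real. (\<bar>h\<bar> powr q - \<bar>0\<bar> powr q) / h) \<longlongrightarrow> 0) (at 0)"
      by (metis (no_types, lifting) Lim_cong_within UNIV_I)
    then show ?thesis using 3 by (simp add: DERIV_def phi_p_def)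
  qed
qed

section \<open>The primitive near the origin\<close>

lemma has_real_derivative_primitive:
  assumes "continuous_on UNIV f"
  shows "(primitive f has_real_derivative f x) (at x)"
proof -
  define l m where "l = min 0 x - 1" and "m = max 0 x + 1"
  have lm: "l \<le> m" "l < 0" "0 < m" "l < x" "x < m" by (auto simp: l_def m_def)
  have "((\<lambda>y. LBINT s=ereal 0..ereal y. f s) has_vector_derivative f x) (at x within {l..m})"
    by (rule interval_integral_FTC2) (use lm assms in \<open>auto intro: continuous_on_subset\<close>)
  then show ?thesis
    using lm
    by (simp add: primitive_def [abs_def] has_real_derivative_iff_has_vector_derivative at_within_Icc_at)
qed

lemma primitive_0 [simp]: "primitive f 0 = 0"
  by (simp add: primitive_def)

lemma primitive_neg:
  assumes f: "continuous_on UNIV f" and opp: "\<And>x. b < x \<Longrightarrow> x < a \<Longrightarrow> x \<noteq> 0 \<Longrightarrow> x * f x < 0"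
    and x: "b < x" "x < a" "x \<noteq> 0" and ab: "b < 0" "0 < a"
  shows "primitive f x < 0"
proof (cases "x > 0")
  case True
  obtain z where z: "0 < z" "z < x" "primitive f x - primitive f 0 = (x - 0) * f z"
    using MVT2 [OF True, of "primitive f" f] has_real_derivative_primitive [OF f] by blast
  moreover have "f z < 0" using opp [of z] z x ab by (simp add: mult_less_0_iff)
  ultimately show ?thesis using True by (simp add: mult_pos_neg)
next
  case False
  then have neg: "x < 0" using x by simp
  obtain z where z: "x < z" "z < 0" "primitive f 0 - primitive f x = (0 - x) * f z"
    using MVT2 [OF neg, of "primitive f" f] has_real_derivative_primitive [OF f] by blast
  moreover have "f z > 0" using opp [of z] z x ab by (simp add: mult_less_0_iff)
  ultimately show ?thesis using neg by (simp add: zero_less_mult_iff mult_neg_pos)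
qed

text \<open>Finiteness of the extended nonnegative integral, in the form of a uniform bound for the
  ordinary integrals over all compact intervals close to \<open>x0\<close> on which \<open>g\<close> is continuous and
  positive; these may approach a zero of \<open>g\<close>.\<close>

lemma locally_integrable_near_integral_bound:
  assumes "locally_integrable_near (\<lambda>u. 1 / ennreal (g u)) x0"
  obtains e M where "e > 0"
    "\<And>l m. x0 - e \<le> l \<Longrightarrow> m \<le> x0 + e \<Longrightarrow> continuous_on {l..m} g \<Longrightarrow>
       (\<And>x. x \<in> {l..m} \<Longrightarrow> g x > 0) \<Longrightarrow> integral {l..m} (\<lambda>x. 1 / g x) \<le> M"
proof -
  from assms obtain e where e: "e > 0"
    and fin: "(\<integral>\<^sup>+u\<in>{x0 - e..x0 + e}. 1 / ennreal (g u) \<partial>lborel) < \<infinity>"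
    unfolding locally_integrable_near_def by blast
  define I where "I = (\<integral>\<^sup>+u\<in>{x0 - e..x0 + e}. 1 / ennreal (g u) \<partial>lborel)"
  have "integral {l..m} (\<lambda>x. 1 / g x) \<le> enn2real I"
    if lm: "x0 - e \<le> l" "m \<le> x0 + e" and g: "continuous_on {l..m} g"
      and pos: "\<And>x. x \<in> {l..m} \<Longrightarrow> g x > 0" for l m
  proof -
    have "continuous_on {l..m} (\<lambda>x. 1 / g x)"
      using g pos by (intro continuous_intros) (auto simp: less_le)
    then have int: "set_integrable lborel {l..m} (\<lambda>x. 1 / g x)"
      by (rule borel_integrable_atLeastAtMost')
    have "ennreal (integral {l..m} (\<lambda>x. 1 / g x))
        = ennreal (LINT x:{l..m}|lborel. 1 / g x)"
      using set_borel_integral_eq_integral(2) [OF int] by simp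
    also have "\<dots> = (\<integral>\<^sup>+x. ennreal (indicator {l..m} x *\<^sub>R (1 / g x)) \<partial>lborel)"
      unfolding set_lebesgue_integral_def using int unfolding set_integrable_def
      by (intro nn_integral_eq_integral [symmetric])
        (auto simp: indicator_def intro!: AE_I2 less_imp_le [OF pos] split: if_splits)
    also have "\<dots> \<le> I"
      unfolding I_def
    proof (rule nn_integral_mono)
      fix x
      show "ennreal (indicator {l..m} x *\<^sub>R (1 / g x))
          \<le> 1 / ennreal (g x) * indicator {x0 - e..x0 + e} x"
      proof (cases "x \<in> {l..m}")
        case True
        then have "x \<in> {x0 - e..x0 + e}" using lm by auto
        moreover have "ennreal (1 / g x) = 1 / ennreal (g x)"
          using divide_ennreal [of 1 "g x"] pos [OF True] by simp
        ultimately show ?thesis using True by simp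
      qed simp
    qed
    finally have le: "ennreal (integral {l..m} (\<lambda>x. 1 / g x)) \<le> I" .
    have "I < top" using fin by (simp add: I_def)
    then have "I = ennreal (enn2real I)" by simp
    then show ?thesis using le by (metis enn2real_nonneg ennreal_le_iff)
  qed
  with e that show thesis by blast
qed

section \<open>Finite travel time\<close>

text \<open>A positive function cannot satisfy \<open>v' K(v) \<le> -C < 0\<close> for all time if the integrals of \<open>K\<close>
  are bounded near \<open>0\<close>: by the change of variables \<open>x = v(r)\<close>, the time spent is at most \<open>M / C\<close>.\<close>

lemma travel_time_bound:
  fixes v v' K :: "real \<Rightarrow> real"
  assumes der: "\<And>r. R \<le> r \<Longrightarrow> (v has_real_derivative v' r) (at r)"
    and v: "\<And>r. R \<le> r \<Longrightarrow> 0 < v r \<and> v r < c"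
    and K: "continuous_on {0<..<c} K" "\<And>x. 0 < x \<Longrightarrow> x < c \<Longrightarrow> 0 < K x"
    and decay: "\<And>r. R \<le> r \<Longrightarrow> v' r * K (v r) \<le> - C" and "0 < C"
    and bound: "\<And>l m. 0 < l \<Longrightarrow> l \<le> m \<Longrightarrow> m < c \<Longrightarrow> integral {l..m} K \<le> M"
  shows False
proof -
  have "C * (r - R) \<le> M" if "R \<le> r" for r
  proof -
    have v'neg: "v' s \<le> 0" if "R \<le> s" for s
    proof -
      have "v' s * K (v s) < 0" using decay [OF that] \<open>0 < C\<close> by linarith
      then show ?thesis using K(2) [of "v s"] v [OF that] by (auto simp: mult_less_0_iff)
    qed
    have anti: "v y \<le> v x" if "R \<le> x" "x \<le> y" for x y
      by (rule DERIV_nonpos_imp_nonincreasing [OF \<open>x \<le> y\<close>])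
        (use that der v'neg order_trans in blast)
    \<comment> \<open>Enlarging the range of \<open>v\<close> on \<open>[R, r]\<close> to \<open>{l..m}\<close> avoids one-sided derivatives of \<open>H\<close>.\<close>
    define l where "l = v r / 2"
    define m where "m = (v R + c) / 2"
    have l: "0 < l" "l < v r" and m: "v R < m" "m < c"
      using v [of r] v [of R] that by (auto simp: l_def m_def)
    have contK: "continuous_on {l..m} K"
      by (rule continuous_on_subset [OF K(1)]) (use l m in auto)
    define H where "H = (\<lambda>x. integral {l..x} K)"
    have derH: "(H has_real_derivative K x) (at x)" if "l < x" "x < m" for x
      using integral_has_real_derivative [OF contK, of x] that
      by (simp add: H_def at_within_Icc_at)
    have comp: "((\<lambda>s. H (v s) + C * s) has_real_derivative K (v s) * v' s + C) (at s)"
      if "R \<le> s" "s \<le> r" for s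
    proof -
      have "l < v s" "v s < m" using anti [of s r] anti [of R s] l m that by auto
      then have "((\<lambda>s. H (v s)) has_real_derivative K (v s) * v' s) (at s)"
        using DERIV_chain2 [OF derH der] that by blast
      then show ?thesis by (auto intro!: derivative_eq_intros)
    qed
    have "H (v r) + C * r \<le> H (v R) + C * R"
      by (rule DERIV_nonpos_imp_nonincreasing [OF \<open>R \<le> r\<close>])
        (use comp decay in \<open>force simp: mult.commute\<close>)
    moreover have "H (v R) = H (v r) + integral {v r..v R} K"
      unfolding H_def
      by (rule Henstock_Kurzweil_Integration.integral_combine [symmetric])
        (use l m anti [of R r] that in \<open>auto intro!: integrable_continuous_real
          intro: continuous_on_subset [OF contK]\<close>)
    moreover have "integral {v r..v R} K \<le> M"
      using bound [of "v r" "v R"] anti [of R r] v that by auto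
    ultimately show ?thesis by (simp add: algebra_simps)
  qed
  from this [of "R + (\<bar>M\<bar> + 1) / C"] show False
    using \<open>0 < C\<close> by simp
qed

section \<open>Radial solutions\<close>

text \<open>The equation for \<open>r > 0\<close>, both in expanded form, for \<open>phi_p p u'\<close>, and in flux form.\<close>

lemma radial_solutionE:
  assumes "radial_solution N p f u"
  obtains u' where
    "\<And>r. 0 < r \<Longrightarrow> (u has_real_derivative u' r) (at r)"
    "\<And>r. 0 < r \<Longrightarrow> ((\<lambda>t. phi_p p (u' t)) has_real_derivative
        (- f (u r) - real (N - 1) / r * phi_p p (u' r))) (at r)"
    "\<And>r. 0 < r \<Longrightarrow> ((\<lambda>t. t ^ (N - 1) * phi_p p (u' t)) has_real_derivative
        (- (r ^ (N - 1) * f (u r)))) (at r)"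
proof -
  from assms obtain u' where
    u: "\<And>r. 0 \<le> r \<Longrightarrow> (u has_real_derivative u' r) (at r within {0..})"
    and C1: "(\<lambda>r. phi_p p (u' r)) C1_differentiable_on {0<..}"
    and eq: "\<And>r. 0 < r \<Longrightarrow>
      deriv (\<lambda>t. t ^ (N - 1) * phi_p p (u' t)) r + r ^ (N - 1) * f (u r) = 0"
    unfolding radial_solution_def by blast
  from C1 obtain D where
    D: "\<And>r. 0 < r \<Longrightarrow> ((\<lambda>t. phi_p p (u' t)) has_real_derivative D r) (at r)"
    unfolding C1_differentiable_on_def has_real_derivative_iff_has_vector_derivative by auto
  have flux: "((\<lambda>t. t ^ (N - 1) * phi_p p (u' t)) has_real_derivative
      real (N - 1) * r ^ (N - 1 - 1) * phi_p p (u' r) + D r * r ^ (N - 1)) (at r)"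
    if "0 < r" for r
    using DERIV_mult [OF DERIV_pow [of "N - 1" r] D [OF that]] by simp
  have val: "real (N - 1) * r ^ (N - 1 - 1) * phi_p p (u' r) + D r * r ^ (N - 1)
      = - (r ^ (N - 1) * f (u r))" if "0 < r" for r
    using eq [OF that] DERIV_imp_deriv [OF flux [OF that]] by simp
  have "D r = - f (u r) - real (N - 1) / r * phi_p p (u' r)" if "0 < r" for r
  proof -
    have "real (N - 1) * r ^ (N - 1 - 1) = real (N - 1) / r * r ^ (N - 1)"
      using that by (cases "N - 1") auto
    with val [OF that] have "(D r + real (N - 1) / r * phi_p p (u' r) + f (u r)) * r ^ (N - 1) = 0"
      by (simp add: algebra_simps)
    then show ?thesis using that by simp
  qed
  then have "((\<lambda>t. phi_p p (u' t)) has_real_derivative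
      (- f (u r) - real (N - 1) / r * phi_p p (u' r))) (at r)" if "0 < r" for r
    using D [OF that] that by simp
  moreover have "((\<lambda>t. t ^ (N - 1) * phi_p p (u' t)) has_real_derivative
      (- (r ^ (N - 1) * f (u r)))) (at r)" if "0 < r" for r
    using flux [OF that] val [OF that] by simp
  moreover have "(u has_real_derivative u' r) (at r)" if "0 < r" for r
    using u [of r] that at_within_interior [of r "{0..}"] by simp
  ultimately show thesis
    using that by blast
qed


lemma mult_phi_p_nonneg_iff: "0 \<le> x * phi_p p y \<longleftrightarrow> 0 \<le> x * y"
proof (cases "y = 0")
  case False
  then have "0 < \<bar>y\<bar> powr (p - 2)" by simp
  moreover have "x * phi_p p y = \<bar>y\<bar> powr (p - 2) * (x * y)"
    using False by (simp add: phi_p_def algebra_simps)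
  ultimately show ?thesis by (metis less_le_not_le mult_nonneg_nonneg order_less_imp_le zero_le_mult_iff)
qed (simp add: phi_p_def)

text \<open>Nonnegativity of the energy, solved for the potential term.\<close>

lemma energy_nonneg:
  fixes N :: nat
  assumes "1 < p" and f: "continuous_on UNIV f"
    and der: "\<And>r. 0 < r \<Longrightarrow> (u has_real_derivative u' r) (at r)"
    and der_phi: "\<And>r. 0 < r \<Longrightarrow> ((\<lambda>t. phi_p p (u' t)) has_real_derivative
        (- f (u r) - real (N - 1) / r * phi_p p (u' r))) (at r)"
    and lim: "(u \<longlongrightarrow> 0) at_top"
    and "0 < r"
  shows "- primitive f (u r) \<le> (p - 1) / p * \<bar>u' r\<bar> powr p"
proof -
  \<comment> \<open>The conjugate exponent, for which \<open>\<bar>u'\<bar> powr p = \<bar>phi_p p u'\<bar> powr q\<close>.\<close>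
  define q where "q = p / (p - 1)"
  have q: "1 < q" "1 / q = (p - 1) / p"
    using \<open>1 < p\<close> by (auto simp: q_def field_simps)
  have powq: "\<bar>phi_p p s\<bar> powr q = \<bar>s\<bar> powr p" for s
    using \<open>1 < p\<close> by (simp add: abs_phi_p powr_powr q_def)
  define E where "E = (\<lambda>s. 1 / q * \<bar>phi_p p (u' s)\<bar> powr q + primitive f (u s))"
  have derE: "(E has_real_derivative - (real (N - 1) / s * \<bar>u' s\<bar> powr p)) (at s)" if "0 < s" for s
  proof -
    have "((\<lambda>s. \<bar>phi_p p (u' s)\<bar> powr q) has_real_derivative
        q * phi_p q (phi_p p (u' s)) * (- f (u s) - real (N - 1) / s * phi_p p (u' s))) (at s)"
      by (rule DERIV_chain2 [OF has_real_derivative_abs_powr [OF \<open>1 < q\<close>] der_phi [OF that]])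
    then have 1: "((\<lambda>s. \<bar>phi_p p (u' s)\<bar> powr q) has_real_derivative
        q * u' s * (- f (u s) - real (N - 1) / s * phi_p p (u' s))) (at s)"
      using phi_p_conjugate [OF \<open>1 < p\<close>] by (simp add: q_def)
    have 2: "((\<lambda>s. primitive f (u s)) has_real_derivative f (u s) * u' s) (at s)"
      by (rule DERIV_chain2 [OF has_real_derivative_primitive [OF f] der [OF that]])
    have "(E has_real_derivative
        1 / q * (q * u' s * (- f (u s) - real (N - 1) / s * phi_p p (u' s))) + f (u s) * u' s) (at s)"
      unfolding E_def by (rule DERIV_add [OF DERIV_cmult [OF 1] 2])
    moreover have "1 / q * (q * u' s * (- f (u s) - real (N - 1) / s * phi_p p (u' s))) + f (u s) * u' s
        = - (real (N - 1) / s * (u' s * phi_p p (u' s)))"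
    proof -
      have "1 / q * (q * u' s * X) = u' s * X" for X using q(1) by simp
      then show ?thesis by (simp only:) (simp add: algebra_simps)
    qed
    ultimately show ?thesis by (simp only: mult_phi_p)
  qed
  have anti: "E s \<le> E r" if "r \<le> s" for s
  proof (rule DERIV_nonpos_imp_nonincreasing [OF that])
    fix x assume "r \<le> x"
    then have "0 < x" using \<open>0 < r\<close> by simp
    then show "\<exists>y. (E has_real_derivative y) (at x) \<and> y \<le> 0"
      using derE by force
  qed
  have "((\<lambda>s. primitive f (u s)) \<longlongrightarrow> primitive f 0) at_top"
    using DERIV_isCont [OF has_real_derivative_primitive [OF f]] lim isCont_tendsto_compose by blast
  moreover have "\<forall>\<^sub>F s in at_top. primitive f (u s) \<le> E r"
    using eventually_ge_at_top [of r]
  proof eventually_elim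
    case (elim s)
    have "primitive f (u s) \<le> E s" using q(1) by (simp add: E_def)
    then show ?case using anti [OF elim] by simp
  qed
  ultimately have "primitive f 0 \<le> E r"
    by (rule tendsto_upperbound) simp
  then show ?thesis by (simp add: E_def powq q)
qed

text \<open>In the region where \<open>u f(u) \<le> 0\<close>, a decaying solution that does not move towards \<open>0\<close> at
  the radius \<open>r\<close> is zero from \<open>r\<close> on.  The
  hypothesis \<open>0 \<le> u r * u' r\<close> holds in particular at a zero of \<open>u\<close>, so the lemma contains the
  uniqueness of the continuation by zero.\<close>

lemma vanishes_of_flux_nonneg:
  fixes u u' :: "real \<Rightarrow> real"
  assumes "0 < R"
    and der: "\<And>r. 0 < r \<Longrightarrow> (u has_real_derivative u' r) (at r)"
    and flux: "\<And>r. 0 < r \<Longrightarrow> ((\<lambda>t. t ^ n * phi_p p (u' t)) has_real_derivative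
        (- (r ^ n * f (u r)))) (at r)"
    and lim: "(u \<longlongrightarrow> 0) at_top"
    and opp: "\<And>r. R \<le> r \<Longrightarrow> u r * f (u r) \<le> 0"
    and r: "R \<le> r" "0 \<le> u r * u' r" "r \<le> s"
  shows "u s = 0"
proof -
  define P where "P = (\<lambda>t. u t * (t ^ n * phi_p p (u' t)))"
  have Pnn: "0 \<le> P t \<longleftrightarrow> 0 \<le> u t * u' t" if "R \<le> t" for t
  proof -
    have "P t = t ^ n * (u t * phi_p p (u' t))" by (simp add: P_def)
    moreover have "0 < t ^ n" using that \<open>0 < R\<close> by simp
    ultimately have "0 \<le> P t \<longleftrightarrow> 0 \<le> u t * phi_p p (u' t)"
      by (metis less_le_not_le mult_nonneg_nonneg order_less_imp_le zero_le_mult_iff)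
    then show ?thesis by (simp only: mult_phi_p_nonneg_iff)
  qed
  have derP: "(P has_real_derivative
      u' t * (t ^ n * phi_p p (u' t)) + (- (t ^ n * f (u t))) * u t) (at t)" if "0 < t" for t
    unfolding P_def by (rule DERIV_mult [OF der [OF that] flux [OF that]])
  have mono: "P r \<le> P t" if "r \<le> t" for t
  proof (rule DERIV_nonneg_imp_nondecreasing [OF that])
    fix x assume "r \<le> x"
    then have x: "R \<le> x" "0 < x" using r \<open>0 < R\<close> by auto
    have "u' x * (x ^ n * phi_p p (u' x)) + (- (x ^ n * f (u x))) * u x
        = x ^ n * (\<bar>u' x\<bar> powr p - u x * f (u x))"
      by (simp add: algebra_simps flip: mult_phi_p)
    also have "\<dots> \<ge> 0"
      using x opp [OF x(1)] by (intro mult_nonneg_nonneg) (auto intro: order_trans [OF _ powr_ge_zero])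
    finally show "\<exists>y. (P has_real_derivative y) (at x) \<and> 0 \<le> y"
      using derP [OF x(2)] by blast
  qed
  \<comment> \<open>The sign of \<open>P\<close> at \<open>r\<close> persists, so \<open>u\<^sup>2\<close> is nondecreasing beyond \<open>r\<close>.\<close>
  have uu': "0 \<le> u t * u' t" if "r \<le> t" for t
    using mono [OF that] Pnn [of r] Pnn [of t] r that by simp
  have sq: "(u s)\<^sup>2 \<le> (u t)\<^sup>2" if "s \<le> t" for t
  proof (rule DERIV_nonneg_imp_nondecreasing [OF that])
    fix x assume "s \<le> x"
    then have "r \<le> x" "0 < x" using r \<open>0 < R\<close> by auto
    then have "((\<lambda>t. (u t)\<^sup>2) has_real_derivative 2 * (u x * u' x)) (at x)"
      using der [of x] by (auto intro!: derivative_eq_intros)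
    then show "\<exists>y. ((\<lambda>t. (u t)\<^sup>2) has_real_derivative y) (at x) \<and> 0 \<le> y"
      using uu' [OF \<open>r \<le> x\<close>] by (intro exI [of _ "2 * (u x * u' x)"]) simp
  qed
  have "((\<lambda>t. (u t)\<^sup>2) \<longlongrightarrow> 0\<^sup>2) at_top"
    by (intro tendsto_power lim)
  then have "(u s)\<^sup>2 \<le> 0\<^sup>2"
    by (rule tendsto_lowerbound) (use sq in \<open>auto intro: eventually_at_top_linorderI\<close>)
  then show ?thesis by simp
qed

theorem lemma2p1:
  fixes N :: nat and p :: real and f u :: "real \<Rightarrow> real"
  assumes "1 < p" and "p < real N"
    and "H1 f" and "H2 f" and "H3 p f"
    and "radial_solution N p f u"
    and "bounded (u ` {0..})"
  shows "compact_support u"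
proof -
  have f: "continuous_on UNIV f" and f0: "f 0 = 0"
    using \<open>H1 f\<close> by (auto simp: H1_def)
  obtain a b where ab: "0 < a" "b < 0" and "strict_antimono_on {b<..<a} f"
    using \<open>H2 f\<close> unfolding H2_def by blast
  then have opp: "x * f x < 0" if "b < x" "x < a" "x \<noteq> 0" for x
    using monotone_onD [of "{b<..<a}" "(<)" "(>)" f x 0]
      monotone_onD [of "{b<..<a}" "(<)" "(>)" f 0 x] that f0
    by (auto simp: mult_less_0_iff neq_iff)
  define F where "F = primitive f"
  have Fneg: "F x < 0" if "b < x" "x < a" "x \<noteq> 0" for x
    unfolding F_def using primitive_neg [OF f] opp that ab by blast
  have contF: "continuous_on S F" for S
    unfolding F_def using DERIV_isCont [OF has_real_derivative_primitive [OF f]]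
    by (simp add: continuous_at_imp_continuous_on)
  define g where "g = (\<lambda>x. \<bar>F x\<bar> powr (1 / p))"
  have gpos: "0 < g x" if "b < x" "x < a" "x \<noteq> 0" for x
    using Fneg [OF that] by (simp add: g_def)
  have contg: "continuous_on S g" for S
    unfolding g_def using contF \<open>1 < p\<close>
    by (intro continuous_on_powr' continuous_intros) auto
  obtain e M where "0 < e" and M: "\<And>l m. 0 - e \<le> l \<Longrightarrow> m \<le> 0 + e \<Longrightarrow> continuous_on {l..m} g \<Longrightarrow>
       (\<And>x. x \<in> {l..m} \<Longrightarrow> g x > 0) \<Longrightarrow> integral {l..m} (\<lambda>x. 1 / g x) \<le> M"
    using \<open>H3 p f\<close> locally_integrable_near_integral_bound [of g 0]
    unfolding H3_def g_def F_def by blast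
  define c where "c = min (min a (- b)) e"
  have c: "0 < c" "c \<le> a" "c \<le> - b" "c \<le> e"
    using ab \<open>0 < e\<close> by (auto simp: c_def)
  have lim: "(u \<longlongrightarrow> 0) at_top"
    using \<open>radial_solution N p f u\<close> by (simp add: radial_solution_def)
  obtain u' where der: "\<And>r. 0 < r \<Longrightarrow> (u has_real_derivative u' r) (at r)"
    and der_phi: "\<And>r. 0 < r \<Longrightarrow> ((\<lambda>t. phi_p p (u' t)) has_real_derivative
        (- f (u r) - real (N - 1) / r * phi_p p (u' r))) (at r)"
    and flux: "\<And>r. 0 < r \<Longrightarrow> ((\<lambda>t. t ^ (N - 1) * phi_p p (u' t)) has_real_derivative
        (- (r ^ (N - 1) * f (u r)))) (at r)"
    using radial_solutionE [OF \<open>radial_solution N p f u\<close>] by blast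
  have "\<forall>\<^sub>F r in at_top. \<bar>u r\<bar> < c"
    using tendstoD [OF lim \<open>0 < c\<close>] by simp
  then obtain R0 where R0: "\<And>r. R0 \<le> r \<Longrightarrow> \<bar>u r\<bar> < c"
    by (auto simp: eventually_at_top_linorder)
  define R where "R = max R0 1"
  have small: "\<bar>u r\<bar> < c" if "R \<le> r" for r
    using R0 [of r] that by (auto simp: R_def)
  have Rpos: "0 < R" by (simp add: R_def)
  have opp_u: "u r * f (u r) \<le> 0" if "R \<le> r" for r
    using opp [of "u r"] small [OF that] c by (cases "u r = 0") (auto simp: less_imp_le)
  have vanishes: "u s = 0" if "R \<le> r" "0 \<le> u r * u' r" "r \<le> s" for r s
    using vanishes_of_flux_nonneg [OF Rpos der flux lim opp_u that] .
  have "\<exists>r\<ge>R. u r = 0"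
  proof (rule ccontr)
    assume "\<not> (\<exists>r\<ge>R. u r = 0)"
    then have nz: "u r \<noteq> 0" if "R \<le> r" for r
      using that by blast
    \<comment> \<open>By continuity \<open>u\<close> keeps its sign \<open>\<sigma>\<close>; reflection by \<open>\<sigma>\<close> reduces to a positive function \<open>v\<close>.\<close>
    define \<sigma> where "\<sigma> = sgn (u R)"
    have \<sigma>: "\<sigma> = 1 \<or> \<sigma> = - 1" "\<sigma> * \<sigma> = 1"
      using nz [of R] by (auto simp: \<sigma>_def sgn_if)
    define v where "v = (\<lambda>r. \<sigma> * u r)"
    have vpos: "0 < v r" if "R \<le> r" for r
    proof (rule ccontr)
      assume "\<not> 0 < v r"
      moreover have "0 < v R" using nz [of R] by (simp add: v_def \<sigma>_def sgn_if)
      moreover have "continuous_on {R..r} v"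
        unfolding v_def using der Rpos
        by (intro continuous_on_mult_left continuous_at_imp_continuous_on ballI)
          (metis DERIV_isCont atLeastAtMost_iff less_le_trans)
      ultimately obtain x where "R \<le> x" "v x = 0"
        using IVT2' [of v r 0 R] \<open>R \<le> r\<close> by (auto simp: not_less)
      then show False using nz [of x] \<sigma> by (auto simp: v_def)
    qed
    have v: "0 < v r \<and> v r < c" if "R \<le> r" for r
      using vpos [OF that] small [OF that] \<sigma> by (auto simp: v_def)
    define K where "K = (\<lambda>x. 1 / g (\<sigma> * x))"
    have g\<sigma>: "0 < g (\<sigma> * x)" if "0 < x" "x < c" for x
      using gpos [of "\<sigma> * x"] \<sigma>(1) c that by auto
    have contK: "continuous_on {0<..<c} K"
      unfolding K_def using g\<sigma>
      by (intro continuous_intros continuous_on_compose2 [OF contg [of UNIV]]) (auto simp: less_le)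
    have bound: "integral {l..m} K \<le> M" if "0 < l" "l \<le> m" "m < c" for l m
      using \<sigma>(1)
    proof
      assume "\<sigma> = 1"
      then show ?thesis
        using M [of l m] contg g\<sigma> c that by (simp add: K_def)
    next
      assume "\<sigma> = - 1"
      then have "integral {l..m} K = integral {- m..- l} (\<lambda>x. 1 / g x)"
        using Henstock_Kurzweil_Integration.integral_reflect_real [of "- l" "- m" "\<lambda>x. 1 / g x"]
        by (simp add: K_def)
      also have "\<dots> \<le> M"
        using that c by (intro M contg gpos) auto
      finally show ?thesis .
    qed
    define C where "C = 1 / ((p - 1) / p) powr (1 / p)"
    have "0 < C" using \<open>1 < p\<close> by (simp add: C_def)
    have decay: "\<sigma> * u' r * K (v r) \<le> - C" if "R \<le> r" for r
    proof -
      have "0 < r" using that Rpos by simp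
      have ur: "\<sigma> * v r = u r" using \<sigma> by (auto simp: v_def)
      have "u r * u' r < 0"
        using vanishes [OF that, of r] nz [OF that] by force
      then have "\<sigma> * u' r < 0"
        using vpos [OF that] \<sigma>(1) by (auto simp: v_def mult_less_0_iff)
      then have u': "\<sigma> * u' r = - \<bar>u' r\<bar>" using \<sigma>(1) by auto
      have "F (u r) < 0"
        using Fneg small [OF that] nz [OF that] c by auto
      then have "\<bar>F (u r)\<bar> \<le> (p - 1) / p * \<bar>u' r\<bar> powr p"
        using energy_nonneg [OF \<open>1 < p\<close> f der der_phi lim \<open>0 < r\<close>] by (simp add: F_def)
      then have "g (u r) \<le> ((p - 1) / p * \<bar>u' r\<bar> powr p) powr (1 / p)"
        unfolding g_def using \<open>1 < p\<close> by (intro powr_mono2) auto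
      also have "\<dots> = ((p - 1) / p) powr (1 / p) * \<bar>u' r\<bar>"
        using \<open>1 < p\<close> by (subst powr_mult) (auto simp: powr_powr)
      finally have "C * g (u r) \<le> \<bar>u' r\<bar>"
        using \<open>1 < p\<close> by (simp add: C_def field_simps)
      moreover have "0 < g (u r)" using g\<sigma> [of "v r"] v [OF that] ur by simp
      ultimately show ?thesis
        by (simp add: K_def ur u' field_simps)
    qed
    show False
    proof (rule travel_time_bound [of R v "\<lambda>r. \<sigma> * u' r" c K C M])
      show "(v has_real_derivative \<sigma> * u' r) (at r)" if "R \<le> r" for r
        unfolding v_def using that Rpos by (intro DERIV_cmult der) simp
      show "0 < K x" if "0 < x" "x < c" for x
        using g\<sigma> [OF that] by (simp add: K_def)
    qed (use v contK decay \<open>0 < C\<close> bound in auto)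
  qed
  then obtain r1 where r1: "R \<le> r1" "u r1 = 0" by blast
  have "{r. 0 \<le> r \<and> u r \<noteq> 0} \<subseteq> {0..r1}"
    using vanishes [OF r1(1)] r1(2) by auto (metis linear)
  then have "bounded {r. 0 \<le> r \<and> u r \<noteq> 0}"
    by (rule bounded_subset [OF bounded_closed_interval])
  then show ?thesis
    by (simp add: compact_support_def compact_closure)
qed

end
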